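(* If a tree $G$ is great-circle thrackleable, then $G$ is an augmented caterpillar.
   Context: Graphs are finite, simple and undirected. A thrackle is a drawing of a graph in which no curve (edge) crosses itself and every pair of curves (edges) intersects at exactly one point (so two edges with a common endpoint meet only at that endpoint, and two edges with no common endpoint meet at exactly one point). A great-circle thrackle is a thrackle drawn on the unit sphere $S^2$ whose vertices are represented as (distinct) points of the sphere and whose edges are represented by arcs of great circles joining their endpoints (an arc may be shorter or longer than $\pi$). It is in general position if no three vertices lie on the same great circle and no two vertices are antipodal. A graph is great-circle thrackleable if it can be drawn as a great-circle thrackle in general position. An augmented caterpillar is a tree consisting of a spine, which is a longest path of the tree, and legs, which are paths that are edge-disjoint from the spine but which terminate at internal vertices of the spine, such that every vertex of the tree is at distance at most two from an internal vertex of the spine. (Trees with at most two vertices, whose spine has no internal vertex, are counted as augmented caterpillars by convention.) *)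

theory Defs
  imports "HOL-Analysis.Analysis" "Graph_Theory.Graph_Theory"
begin

text \<open>
  A finite simple undirected graph is a symmetric digraph in the sense of the locale
  \<^locale>\<open>graph\<close>: every undirected edge is a pair of opposite arcs. The undirected edges are
  recovered as two-element sets of vertices.
\<close>

definition uedges :: "('a,'b) pre_digraph \<Rightarrow> 'a set set" where
  "uedges G = (\<lambda>(u, v). {u, v}) ` arcs_ends G"

definition vwalk_uedges :: "'a vwalk \<Rightarrow> 'a set set" where
  "vwalk_uedges p = (\<lambda>(u, v). {u, v}) ` set (vwalk_arcs p)"

text \<open>
  The constant \<^const>\<open>Digraph_Component.tree\<close> is unsuitable here: in a symmetric digraph each
  edge traversed back and forth is a \<^const>\<open>pre_digraph.cycle\<close> of length 2. The cycles of the
  undirected graph are those of length at least 3.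
\<close>

definition undirected_tree :: "('a,'b) pre_digraph \<Rightarrow> bool" where
  "undirected_tree G \<longleftrightarrow>
     graph G \<and> Digraph_Component.connected G \<and>
     \<not> (\<exists>p. pre_digraph.cycle G p \<and> 3 \<le> length p)"

definition longest_path :: "('a,'b) pre_digraph \<Rightarrow> 'a vwalk \<Rightarrow> bool" where
  "longest_path G s \<longleftrightarrow> vpath s G \<and> (\<forall>p. vpath p G \<longrightarrow> length p \<le> length s)"

definition internal_verts :: "'a vwalk \<Rightarrow> 'a set" where
  "internal_verts p = set (butlast (tl p))"

definition leg :: "('a,'b) pre_digraph \<Rightarrow> 'a vwalk \<Rightarrow> 'a vwalk \<Rightarrow> bool" where
  "leg G s l \<longleftrightarrow>
     vpath l G \<and> vwalk_uedges l \<inter> vwalk_uedges s = {} \<and> last l \<in> internal_verts s"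

text \<open>
  Distances are measured by \<^const>\<open>wf_digraph.\<mu>\<close> with unit arc weights. Legs must be
  edge-disjoint from the spine, but not from each other. Trees with at most two vertices, where
  the spine has no internal vertex, are included by convention.
\<close>

definition augmented_caterpillar :: "('a,'b) pre_digraph \<Rightarrow> bool" where
  "augmented_caterpillar G \<longleftrightarrow>
     undirected_tree G \<and>
     (card (verts G) \<le> 2 \<or>
      (\<exists>s L. longest_path G s \<and> (\<forall>l\<in>L. leg G s l) \<and>
         verts G = set s \<union> (\<Union>l\<in>L. set l) \<and>
         uedges G = vwalk_uedges s \<union> (\<Union>l\<in>L. vwalk_uedges l) \<and>
         (\<forall>v\<in>verts G. \<exists>w\<in>internal_verts s. wf_digraph.\<mu> G (\<lambda>_. 1) v w \<le> 2)))"

text \<open>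
  A drawing places the vertices at distinct points \<open>pos v\<close> and assigns to each undirected edge
  \<open>e\<close> a path \<open>c e\<close>, in either direction, joining the positions of its two ends. That edges avoid
  all other vertices need not be required: for great-circle drawings it follows from general
  position.
\<close>

definition drawing ::
  "('a,'b) pre_digraph \<Rightarrow> ('a \<Rightarrow> real^3) \<Rightarrow> ('a set \<Rightarrow> real \<Rightarrow> real^3) \<Rightarrow> bool" where
  "drawing G pos c \<longleftrightarrow>
     inj_on pos (verts G) \<and>
     (\<forall>e\<in>uedges G. path (c e) \<and> {pathstart (c e), pathfinish (c e)} = pos ` e)"

definition thrackle ::
  "('a,'b) pre_digraph \<Rightarrow> ('a \<Rightarrow> real^3) \<Rightarrow> ('a set \<Rightarrow> real \<Rightarrow> real^3) \<Rightarrow> bool" where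
  "thrackle G pos c \<longleftrightarrow>
     drawing G pos c \<and>
     (\<forall>e\<in>uedges G. arc (c e)) \<and>
     (\<forall>e\<in>uedges G. \<forall>f\<in>uedges G. e \<noteq> f \<longrightarrow>
        (\<exists>!x. x \<in> path_image (c e) \<inter> path_image (c f)))"

definition great_circle :: "(real^3) set \<Rightarrow> bool" where
  "great_circle C \<longleftrightarrow> (\<exists>n. n \<noteq> 0 \<and> C = {x \<in> sphere 0 1. n \<bullet> x = 0})"

text \<open>
  An arc of length \<open>l\<close> that starts at \<open>a\<close> in the direction of the unit tangent vector \<open>b\<close>. Any
  length less than that of the full circle is allowed, so both the short and the long arc between
  two non-antipodal points are covered.
\<close>

definition great_circle_arc :: "(real \<Rightarrow> real^3) \<Rightarrow> bool" where
  "great_circle_arc g \<longleftrightarrow>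
     (\<exists>a b l. norm a = 1 \<and> norm b = 1 \<and> a \<bullet> b = 0 \<and> 0 < l \<and> l < 2 * pi \<and>
        (\<forall>t\<in>{0..1}. g t = cos (l * t) *\<^sub>R a + sin (l * t) *\<^sub>R b))"

definition great_circle_thrackle ::
  "('a,'b) pre_digraph \<Rightarrow> ('a \<Rightarrow> real^3) \<Rightarrow> ('a set \<Rightarrow> real \<Rightarrow> real^3) \<Rightarrow> bool" where
  "great_circle_thrackle G pos c \<longleftrightarrow>
     thrackle G pos c \<and> pos ` verts G \<subseteq> sphere 0 1 \<and> (\<forall>e\<in>uedges G. great_circle_arc (c e))"

definition general_position :: "('a,'b) pre_digraph \<Rightarrow> ('a \<Rightarrow> real^3) \<Rightarrow> bool" where
  "general_position G pos \<longleftrightarrow>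
     (\<forall>u\<in>verts G. \<forall>v\<in>verts G. \<forall>w\<in>verts G. distinct [u, v, w] \<longrightarrow>
        \<not> (\<exists>C. great_circle C \<and> {pos u, pos v, pos w} \<subseteq> C)) \<and>
     (\<forall>u\<in>verts G. \<forall>v\<in>verts G. u \<noteq> v \<longrightarrow> pos u \<noteq> - pos v)"

definition great_circle_thrackleable :: "('a,'b) pre_digraph \<Rightarrow> bool" where
  "great_circle_thrackleable G \<longleftrightarrow>
     (\<exists>pos c. great_circle_thrackle G pos c \<and> general_position G pos)"

end

theory Submission
  imports Defs
begin

text \<open>
  A tree that is not an augmented caterpillar contains a spider with three legs of length three:
  the legs are the last three edges of a path joining a far vertex to the spine and the three
  spine edges on either side of the attaching vertex. Such a spider is not great-circle thrackleable.
  Call an edge long if its arc is longer than \<open>\<pi>\<close>. Two adjacent edges cannot both be long, as they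
  would also meet at the antipode of their common vertex. Whether two disjoint edges cross exactly
  once depends only on their lengths and on the orientations of the triples among their four ends,
  and the orientations obey the Grassmann--Pluecker relations. From this one obtains two facts:
  in a path with six edges the second and the fifth edge are not both long, and in a spider
  with legs of lengths 3, 2, 2 at least one of the two short legs has a long outer edge. Hence of
  the three middle edges of the spider at least two are long, but no two of them are.
\<close>

section \<open>Orientations of triples\<close>

text \<open>
  Here \<open>ccw x y z\<close> is the sign of the determinant of \<open>x, y, z\<close>. Up to a positive factor the great
  circles through \<open>a, b\<close> and \<open>c, d\<close> meet at \<open>\<plusminus>w\<close>, where
  \<open>w = [a b d] c - [a b c] d = [a c d] b - [b c d] a\<close>. The two sides of the outer inequality say that
  \<open>w\<close>, respectively \<open>-w\<close>, lies on both arcs: a short arc consists of the combinations of its ends with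
  nonnegative coefficients, a long one of those in which not both coefficients are positive.
\<close>

definition crosses_once :: "('v \<Rightarrow> 'v \<Rightarrow> 'v \<Rightarrow> bool) \<Rightarrow> ('v set \<Rightarrow> bool) \<Rightarrow> 'v \<Rightarrow> 'v \<Rightarrow> 'v \<Rightarrow> 'v \<Rightarrow> bool" where
  "crosses_once ccw long a b c d \<longleftrightarrow>
    ((ccw a b d \<and> \<not> ccw a b c) \<noteq> long {c, d} \<and> (ccw a c d \<and> \<not> ccw b c d) \<noteq> long {a, b}) \<noteq>
    ((ccw a b c \<and> \<not> ccw a b d) \<noteq> long {c, d} \<and> (ccw b c d \<and> \<not> ccw a c d) \<noteq> long {a, b})"

text \<open>
  The Grassmann--Pluecker relation says that \<open>[x a b] [x c d]\<close>, \<open>- [x a c] [x b d]\<close> and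
  \<open>[x a d] [x b c]\<close> add up to zero; hence they do not all have the same sign.
\<close>

locale sign_thrackle =
  fixes V :: "'v set" and E :: "'v set set"
    and ccw :: "'v \<Rightarrow> 'v \<Rightarrow> 'v \<Rightarrow> bool" and long :: "'v set \<Rightarrow> bool"
  assumes swap: "\<lbrakk>{x, y, z} \<subseteq> V; distinct [x, y, z]\<rbrakk> \<Longrightarrow> ccw y x z \<longleftrightarrow> \<not> ccw x y z"
    and rotate: "ccw y z x \<longleftrightarrow> ccw x y z"
    and grassmann_pluecker: "\<lbrakk>{x, a, b, c, d} \<subseteq> V; distinct [x, a, b, c, d]\<rbrakk> \<Longrightarrow>
      \<not> ((ccw x a b = ccw x c d) = (ccw x a d = ccw x b c) \<and>
          (ccw x a b = ccw x c d) = (ccw x a c \<noteq> ccw x b d))"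
    and edge_verts: "\<Union>E \<subseteq> V"
    and adjacent: "\<lbrakk>{v, a} \<in> E; {v, b} \<in> E; a \<noteq> b\<rbrakk> \<Longrightarrow> \<not> (long {v, a} \<and> long {v, b})"
    and crossing: "\<lbrakk>{a, b} \<in> E; {c, d} \<in> E; distinct [a, b, c, d]\<rbrakk> \<Longrightarrow> crosses_once ccw long a b c d"
begin

text \<open>If both were long, the other four edges would be short. The short edge from
  \<open>a3\<close> to \<open>a2\<close> makes \<open>ccw a2 a1 u\<close> and
  \<open>ccw a2 u b1\<close> opposite; the one from \<open>b2\<close> to \<open>b3\<close> does the
  same to \<open>ccw a1 u b2\<close> and \<open>ccw u b1 b2\<close>. Up to reflection, the crossings
  with one long edge then fix all relevant triples not containing both \<open>a2\<close> and
  \<open>b2\<close>. The relations at \<open>a1\<close> and \<open>b1\<close> fix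
  \<open>ccw a2 a1 b2\<close> and \<open>ccw a2 b1 b2\<close>, and the two long arcs turn out to
  meet at both \<open>w\<close> and \<open>-w\<close>.\<close>

lemma not_both_long:
  assumes E: "{a3, a2} \<in> E" "{a2, a1} \<in> E" "{a1, u} \<in> E" "{u, b1} \<in> E" "{b1, b2} \<in> E" "{b2, b3} \<in> E"
    and d: "distinct [a3, a2, a1, u, b1, b2, b3]"
  shows "\<not> (long {a2, a1} \<and> long {b1, b2})"
proof
  assume l: "long {a2, a1} \<and> long {b1, b2}"
  have V: "{a3, a2, a1, u, b1, b2, b3} \<subseteq> V" using E edge_verts by blast
  have "\<not> long {a3, a2}" "\<not> long {a1, u}" "\<not> long {u, b1}" "\<not> long {b2, b3}"
    using l d adjacent[of a2 a3 a1] adjacent[of a1 a2 u] adjacent[of b1 u b2] adjacent[of b2 b1 b3] E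
    by (simp_all add: insert_commute)
  moreover have "crosses_once ccw long a3 a2 a1 u" "crosses_once ccw long a3 a2 u b1"
    "crosses_once ccw long a2 a1 u b1" "crosses_once ccw long a2 a1 b1 b2"
    "crosses_once ccw long a1 u b1 b2" "crosses_once ccw long a1 u b2 b3" "crosses_once ccw long u b1 b2 b3"
    using E d by (simp_all add: crossing)
  moreover have
    "\<not> ((ccw a1 a2 u = ccw a1 b1 b2) = (ccw a1 a2 b2 = ccw a1 u b1) \<and>
          (ccw a1 a2 u = ccw a1 b1 b2) = (ccw a1 a2 b1 \<noteq> ccw a1 u b2))"
    "\<not> ((ccw b1 a2 a1 = ccw b1 u b2) = (ccw b1 a2 b2 = ccw b1 a1 u) \<and>
          (ccw b1 a2 a1 = ccw b1 u b2) = (ccw b1 a2 u \<noteq> ccw b1 a1 b2))"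
    using V d by (intro grassmann_pluecker; auto)+
  moreover note l
  \<comment> \<open>For \<open>sat\<close>, differently ordered triples are unrelated atoms. These
    equations translate the triples of the two relations into the order used by the
    crossings.\<close>
  moreover have "ccw a1 a2 u = (\<not> ccw a2 a1 u)" "ccw a1 a2 b1 = (\<not> ccw a2 a1 b1)" "ccw a1 a2 b2 = (\<not> ccw a2 a1 b2)"
    using V d by (auto simp: swap)
  moreover have "ccw b1 a2 a1 = ccw a2 a1 b1" "ccw b1 a2 u = ccw a2 u b1" "ccw b1 a1 u = ccw a1 u b1"
    by (rule rotate[symmetric])+
  moreover have
    "ccw b1 u b2 = (\<not> ccw u b1 b2)" "ccw b1 a1 b2 = (\<not> ccw a1 b1 b2)" "ccw b1 a2 b2 = (\<not> ccw a2 b1 b2)"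
    using V d by (auto simp: swap)
  ultimately show False unfolding crosses_once_def by sat
qed

text \<open>Suppose both are short and compare \<open>ccw u b1 b2\<close> with
  \<open>ccw u c1 c2\<close>. The crossings between the two short legs make them opposite if
  \<open>{u, b1}\<close> and \<open>{u, c1}\<close> are both short, and equal if one of these is
  long. The crossings with the third leg force the reverse in each case. The Grassmann--Pluecker
  relations enter when \<open>{a2, a1}\<close> and one of \<open>{u, b1}\<close>,
  \<open>{u, c1}\<close> are both long.\<close>

lemma outer_edge_long:
  assumes E: "{a3, a2} \<in> E" "{a2, a1} \<in> E" "{a1, u} \<in> E"
      "{u, b1} \<in> E" "{b1, b2} \<in> E" "{u, c1} \<in> E" "{c1, c2} \<in> E"
    and d: "distinct [a3, a2, a1, u, b1, b2, c1, c2]"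
  shows "long {b1, b2} \<or> long {c1, c2}"
proof (rule ccontr)
  assume l: "\<not> (long {b1, b2} \<or> long {c1, c2})"
  have d': "distinct [b1, b2, u, c1]" using d by auto
  have V: "{a3, a2, a1, u, b1, b2, c1, c2} \<subseteq> V" using E edge_verts by blast
  have "\<not> (long {a3, a2} \<and> long {a2, a1})" "\<not> (long {a2, a1} \<and> long {a1, u})"
    "\<not> (long {a1, u} \<and> long {u, b1})" "\<not> (long {a1, u} \<and> long {u, c1})" "\<not> (long {u, b1} \<and> long {u, c1})"
    using d adjacent[of a2 a3 a1] adjacent[of a1 a2 u] adjacent[of u a1 b1] adjacent[of u a1 c1]
      adjacent[of u b1 c1] E
    by (simp_all add: insert_commute)
  moreover have "crosses_once ccw long a3 a2 a1 u" "crosses_once ccw long a3 a2 u b1"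
    "crosses_once ccw long a3 a2 b1 b2" "crosses_once ccw long a3 a2 u c1" "crosses_once ccw long a3 a2 c1 c2"
    "crosses_once ccw long a2 a1 u b1" "crosses_once ccw long a2 a1 b1 b2"
    "crosses_once ccw long a2 a1 u c1" "crosses_once ccw long a2 a1 c1 c2"
    "crosses_once ccw long a1 u b1 b2" "crosses_once ccw long a1 u c1 c2"
    "crosses_once ccw long u b1 c1 c2" "crosses_once ccw long b1 b2 u c1" "crosses_once ccw long b1 b2 c1 c2"
    using E d d' by (simp_all add: crossing)
  moreover have
    "\<not> ((ccw b1 a2 a1 = ccw b1 u b2) = (ccw b1 a2 b2 = ccw b1 a1 u) \<and>
          (ccw b1 a2 a1 = ccw b1 u b2) = (ccw b1 a2 u \<noteq> ccw b1 a1 b2))"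
    "\<not> ((ccw c1 a2 a1 = ccw c1 u c2) = (ccw c1 a2 c2 = ccw c1 a1 u) \<and>
          (ccw c1 a2 a1 = ccw c1 u c2) = (ccw c1 a2 u \<noteq> ccw c1 a1 c2))"
    using V d by (intro grassmann_pluecker; auto)+
  moreover note l
  moreover have "ccw b1 a2 a1 = ccw a2 a1 b1" "ccw b1 a2 u = ccw a2 u b1" "ccw b1 a1 u = ccw a1 u b1"
    "ccw c1 a2 a1 = ccw a2 a1 c1" "ccw c1 a2 u = ccw a2 u c1" "ccw c1 a1 u = ccw a1 u c1"
    "ccw b1 b2 u = ccw u b1 b2"
    by (rule rotate[symmetric] rotate)+
  moreover have
    "ccw b1 u b2 = (\<not> ccw u b1 b2)" "ccw b1 a1 b2 = (\<not> ccw a1 b1 b2)" "ccw b1 a2 b2 = (\<not> ccw a2 b1 b2)"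
    "ccw c1 u c2 = (\<not> ccw u c1 c2)" "ccw c1 a1 c2 = (\<not> ccw a1 c1 c2)" "ccw c1 a2 c2 = (\<not> ccw a2 c1 c2)"
    "ccw b1 u c1 = (\<not> ccw u b1 c1)" "ccw b2 u c1 = (\<not> ccw u b2 c1)"
    using V d by (auto simp: swap)
  ultimately show False unfolding crosses_once_def by sat
qed

lemma no_spider:
  assumes E: "{a3, a2} \<in> E" "{a2, a1} \<in> E" "{a1, u} \<in> E" "{b3, b2} \<in> E" "{b2, b1} \<in> E" "{b1, u} \<in> E"
      "{c3, c2} \<in> E" "{c2, c1} \<in> E" "{c1, u} \<in> E"
    and d: "distinct [u, a1, a2, a3, b1, b2, b3, c1, c2, c3]"
  shows False
proof -
  have "long {b1, b2} \<or> long {c1, c2}" "long {a1, a2} \<or> long {c1, c2}" "long {a1, a2} \<or> long {b1, b2}"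
    using outer_edge_long[of a3 a2 a1 u b1 b2 c1 c2] outer_edge_long[of b3 b2 b1 u a1 a2 c1 c2]
      outer_edge_long[of c3 c2 c1 u a1 a2 b1 b2] E d by (auto simp: insert_commute)
  moreover have "\<not> (long {a1, a2} \<and> long {b1, b2})" "\<not> (long {a1, a2} \<and> long {c1, c2})"
    "\<not> (long {b1, b2} \<and> long {c1, c2})"
    using not_both_long[of a3 a2 a1 u b1 b2 b3] not_both_long[of a3 a2 a1 u c1 c2 c3]
      not_both_long[of b3 b2 b1 u c1 c2 c3] E d by (auto simp: insert_commute)
  ultimately show False by blast
qed

end

section \<open>Arcs of great circles\<close>

definition triple :: "real^3 \<Rightarrow> real^3 \<Rightarrow> real^3 \<Rightarrow> real" where
  "triple x y z = cross3 x y \<bullet> z"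

lemma triple_swap: "triple y x z = - triple x y z"
  by (simp add: triple_def cross3_simps)

lemma triple_rotate: "triple y z x = triple x y z"
  by (simp add: triple_def cross3_simps)

lemma triple_lin3: "triple x y (s *\<^sub>R z + t *\<^sub>R w) = s * triple x y z + t * triple x y w"
  by (simp add: triple_def inner_add_right)

lemma triple_same [simp]: "triple x x y = 0" "triple x y x = 0" "triple x y y = 0"
  by (simp_all add: triple_def cross3_simps)

lemma triple_grassmann_pluecker:
  "triple x a b * triple x c d - triple x a c * triple x b d + triple x a d * triple x b c = 0"
  by (simp add: triple_def cross3_simps)

text \<open>Both sides expand the cross product of the normals \<open>cross3 a b\<close> and
  \<open>cross3 c d\<close>, a vector common to the two planes.\<close>

lemma plane_intersection:
  "triple a b d *\<^sub>R c - triple a b c *\<^sub>R d = triple a c d *\<^sub>R b - triple b c d *\<^sub>R a"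
  by (simp add: triple_def cross3_simps forall_3)

text \<open>The arc as a point set without parametrization, so that membership depends only on signs
  of coefficients. For unit \<open>p\<close> and \<open>q\<close> both variants contain these ends,
  where one coefficient vanishes.\<close>

definition circular_arc :: "bool \<Rightarrow> real^3 \<Rightarrow> real^3 \<Rightarrow> (real^3) set" where
  "circular_arc long p q = {x. norm x = 1 \<and>
     (\<exists>s t. x = s *\<^sub>R p + t *\<^sub>R q \<and> (if long then s \<le> 0 \<or> t \<le> 0 else 0 \<le> s \<and> 0 \<le> t))}"

lemma circular_arc_commute: "circular_arc long p q = circular_arc long q p"
proof -
  have "circular_arc long p q \<subseteq> circular_arc long q p" for p q
    unfolding circular_arc_def by (clarsimp, metis add.commute)
  then show ?thesis by blast
qed

lemma combination_in_circular_arc: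
  assumes "triple p q r \<noteq> 0"
  shows "s *\<^sub>R p + t *\<^sub>R q \<in> circular_arc long p q \<longleftrightarrow>
    norm (s *\<^sub>R p + t *\<^sub>R q) = 1 \<and> (if long then s \<le> 0 \<or> t \<le> 0 else 0 \<le> s \<and> 0 \<le> t)"
proof -
  have "s = s' \<and> t = t'" if "s *\<^sub>R p + t *\<^sub>R q = s' *\<^sub>R p + t' *\<^sub>R q" for s' t'
  proof -
    \<comment> \<open>The determinants with \<open>q, r\<close> and with \<open>p, r\<close> isolate
      the first and the second coefficient.\<close>
    have "triple q r (s *\<^sub>R p + t *\<^sub>R q) = s * triple p q r"
      "triple q r (s' *\<^sub>R p + t' *\<^sub>R q) = s' * triple p q r"
      "triple p r (s *\<^sub>R p + t *\<^sub>R q) = - t * triple p q r"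
      "triple p r (s' *\<^sub>R p + t' *\<^sub>R q) = - t' * triple p q r"
      using triple_rotate[of q r p] triple_rotate[of p r q] triple_swap[of q p r]
      by (simp_all add: triple_lin3)
    then show ?thesis using assms that by simp
  qed
  then show ?thesis unfolding circular_arc_def by fastforce
qed

text \<open>The planes of the two arcs share a single line, which meets the sphere in
  \<open>e\<close> and \<open>- e\<close>. A unique common point of the arcs means that exactly one
  of these two lies on both; \<open>?P\<close> expresses this for \<open>e\<close> and
  \<open>?N\<close> for \<open>- e\<close>.\<close>

lemma circular_arcs_crossing:
  assumes nz: "triple a b c \<noteq> 0" "triple a b d \<noteq> 0" "triple a c d \<noteq> 0" "triple b c d \<noteq> 0"
    and ex1: "\<exists>!x. x \<in> circular_arc l a b \<inter> circular_arc m c d"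
  shows
    "((0 < triple a b d \<and> \<not> 0 < triple a b c) \<noteq> m \<and> (0 < triple a c d \<and> \<not> 0 < triple b c d) \<noteq> l) \<noteq>
     ((0 < triple a b c \<and> \<not> 0 < triple a b d) \<noteq> m \<and> (0 < triple b c d \<and> \<not> 0 < triple a c d) \<noteq> l)"
    (is "?P \<noteq> ?N")
proof -
  define w where "w = triple a b d *\<^sub>R c - triple a b c *\<^sub>R d"
  define r where "r = inverse (norm w)"
  define e where "e = r *\<^sub>R w"
  have "triple a c w = - triple a b c * triple a c d"
    using triple_lin3[of a c "triple a b d" c "- triple a b c" d] by (simp add: w_def)
  then have "w \<noteq> 0" using nz by (auto simp: triple_def)
  then have r: "0 < r" and ne: "norm e = 1" by (simp_all add: e_def r_def)
  then have "e \<noteq> - e" by (metis norm_zero one_neq_zero eq_neg_iff_add_eq_0 scaleR_2 scaleR_eq_0_iff zero_neq_numeral)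
  have e1: "e = (r * triple a b d) *\<^sub>R c + (- r * triple a b c) *\<^sub>R d"
    and e2: "- e = (- r * triple a b d) *\<^sub>R c + (r * triple a b c) *\<^sub>R d"
    by (simp_all add: e_def w_def algebra_simps)
  have w: "w = triple a c d *\<^sub>R b - triple b c d *\<^sub>R a"
    unfolding w_def by (rule plane_intersection)
  have e3: "e = (- r * triple b c d) *\<^sub>R a + (r * triple a c d) *\<^sub>R b"
    and e4: "- e = (r * triple b c d) *\<^sub>R a + (- r * triple a c d) *\<^sub>R b"
    by (simp_all add: e_def w algebra_simps)
  have n': "triple c d a \<noteq> 0" using nz triple_rotate[of c d a] by simp
  have scale: "r * x \<le> 0 \<longleftrightarrow> x \<le> 0" "0 \<le> r * x \<longleftrightarrow> 0 \<le> x" "- r * x \<le> 0 \<longleftrightarrow> 0 \<le> x" "0 \<le> - r * x \<longleftrightarrow> x \<le> 0" for x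
    using r by (simp_all add: mult_le_0_iff zero_le_mult_iff)
  \<comment> \<open>No determinant vanishes, so the weak inequalities from the closed arcs become
    the strict signs of the statement.\<close>
  have strict: "triple a b c \<le> 0 \<longleftrightarrow> \<not> 0 < triple a b c" "0 \<le> triple a b c \<longleftrightarrow> 0 < triple a b c"
    "triple a b d \<le> 0 \<longleftrightarrow> \<not> 0 < triple a b d" "0 \<le> triple a b d \<longleftrightarrow> 0 < triple a b d"
    "triple a c d \<le> 0 \<longleftrightarrow> \<not> 0 < triple a c d" "0 \<le> triple a c d \<longleftrightarrow> 0 < triple a c d"
    "triple b c d \<le> 0 \<longleftrightarrow> \<not> 0 < triple b c d" "0 \<le> triple b c d \<longleftrightarrow> 0 < triple b c d"
    using nz by linarith+
  have "e \<in> circular_arc l a b \<longleftrightarrow>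
      (if l then - r * triple b c d \<le> 0 \<or> r * triple a c d \<le> 0 else 0 \<le> - r * triple b c d \<and> 0 \<le> r * triple a c d)"
    "e \<in> circular_arc m c d \<longleftrightarrow>
      (if m then r * triple a b d \<le> 0 \<or> - r * triple a b c \<le> 0 else 0 \<le> r * triple a b d \<and> 0 \<le> - r * triple a b c)"
    using combination_in_circular_arc[OF nz(1), of "- r * triple b c d" "r * triple a c d" l, folded e3]
      combination_in_circular_arc[OF n', of "r * triple a b d" "- r * triple a b c" m, folded e1] ne
    by blast+
  then have P: "e \<in> circular_arc l a b \<inter> circular_arc m c d \<longleftrightarrow> ?P"
    unfolding scale strict Int_iff by (cases l; cases m; simp only: if_True if_False simp_thms; blast)
  have "- e \<in> circular_arc l a b \<longleftrightarrow>
      (if l then r * triple b c d \<le> 0 \<or> - r * triple a c d \<le> 0 else 0 \<le> r * triple b c d \<and> 0 \<le> - r * triple a c d)"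
    "- e \<in> circular_arc m c d \<longleftrightarrow>
      (if m then - r * triple a b d \<le> 0 \<or> r * triple a b c \<le> 0 else 0 \<le> - r * triple a b d \<and> 0 \<le> r * triple a b c)"
    using combination_in_circular_arc[OF nz(1), of "r * triple b c d" "- r * triple a c d" l, folded e4]
      combination_in_circular_arc[OF n', of "- r * triple a b d" "r * triple a b c" m, folded e2] ne
    unfolding norm_minus_cancel by blast+
  then have N: "- e \<in> circular_arc l a b \<inter> circular_arc m c d \<longleftrightarrow> ?N"
    unfolding scale strict Int_iff by (cases l; cases m; simp only: if_True if_False simp_thms; blast)
  have "x = e \<or> x = - e" if "x \<in> circular_arc l a b \<inter> circular_arc m c d" for x
  proof -
    from that obtain s t u v where x: "x = s *\<^sub>R a + t *\<^sub>R b" "x = u *\<^sub>R c + v *\<^sub>R d" "norm x = 1"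
      unfolding circular_arc_def by blast
    \<comment> \<open>The determinant with \<open>a, b\<close> kills the expansion of
      \<open>x\<close> in \<open>a, b\<close>; hence its expansion in \<open>c, d\<close> is
      proportional to that of \<open>w\<close>.\<close>
    have "0 = u * triple a b c + v * triple a b d"
      using triple_lin3[of a b s a t b] triple_lin3[of a b u c v d] x by simp
    then have "u = (- v / triple a b c) * triple a b d" using nz by (simp add: field_simps)
    then have "x = (- v / triple a b c) *\<^sub>R w" using nz by (simp add: x(2) w_def algebra_simps)
    then have "x = (- v / triple a b c * norm w) *\<^sub>R e" by (simp add: e_def r_def \<open>w \<noteq> 0\<close>)
    moreover from this have "\<bar>- v / triple a b c * norm w\<bar> = 1" using x(3) ne by (metis norm_scaleR mult.right_neutral)
    ultimately show ?thesis by (auto simp: abs_if split: if_splits)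
  qed
  with P N ex1 \<open>e \<noteq> - e\<close> show ?thesis by blast
qed

text \<open>The ends are not antipodal, so \<open>l\<close> is not \<open>pi\<close> and
  \<open>sin l\<close> is nonzero. The point at angle \<theta> then has coefficients
  \<open>sin (l - \<theta>) / sin l\<close> and \<open>sin \<theta> / sin l\<close>, whose signs
  decide whether \<theta> is at most \<open>l\<close>.\<close>

lemma great_circle_arc_path_image:
  assumes "great_circle_arc g" "pathstart g = p" "pathfinish g = q" "p \<noteq> - q"
  shows "\<exists>long. path_image g = circular_arc long p q"
proof -
  obtain a b l where ab: "norm a = 1" "norm b = 1" "a \<bullet> b = 0" and l: "0 < l" "l < 2 * pi"
    and g: "\<And>t. t \<in> {0..1} \<Longrightarrow> g t = cos (l * t) *\<^sub>R a + sin (l * t) *\<^sub>R b"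
    using assms(1) unfolding great_circle_arc_def by blast
  have p: "p = a" using assms(2) g[of 0] by (simp add: pathstart_def)
  have q: "q = cos l *\<^sub>R a + sin l *\<^sub>R b" using assms(3) g[of 1] by (simp add: pathfinish_def)
  have "l \<noteq> pi" using assms(4) p q by auto
  then have "sin l \<noteq> 0" using l sin_eq_0_pi[of "l - pi"] by auto
  have img: "path_image g = (\<lambda>\<theta>. cos \<theta> *\<^sub>R a + sin \<theta> *\<^sub>R b) ` {0..l}"
  proof -
    have "path_image g = (\<lambda>\<theta>. cos \<theta> *\<^sub>R a + sin \<theta> *\<^sub>R b) ` (\<lambda>t. l * t) ` {0..1}"
      unfolding path_image_def image_image using g by (rule image_cong[OF refl])
    also have "(\<lambda>t. l * t) ` {0..1} = {0..l}" using l by (simp add: image_mult_atLeastAtMost)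
    finally show ?thesis .
  qed
  have norm1: "norm (x *\<^sub>R a + y *\<^sub>R b) = 1 \<longleftrightarrow> x\<^sup>2 + y\<^sup>2 = 1" for x y
  proof -
    have "(norm (x *\<^sub>R a + y *\<^sub>R b))\<^sup>2 = x\<^sup>2 + y\<^sup>2"
      unfolding power2_norm_eq_inner using ab
      by (simp add: inner_add_left inner_add_right inner_commute norm_eq_1 power2_eq_square)
    then show ?thesis by (metis norm_ge_zero one_power2 power2_eq_iff_nonneg zero_le_one)
  qed
  have "path_image g = circular_arc (l > pi) p q"
  proof (intro equalityI subsetI)
    fix x assume "x \<in> path_image g"
    then obtain \<theta> where \<theta>: "0 \<le> \<theta>" "\<theta> \<le> l" "x = cos \<theta> *\<^sub>R a + sin \<theta> *\<^sub>R b"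
      unfolding img by auto
    have "x = (sin (l - \<theta>) / sin l) *\<^sub>R p + (sin \<theta> / sin l) *\<^sub>R q"
    proof -
      have "sin (l - \<theta>) / sin l + sin \<theta> / sin l * cos l = cos \<theta>"
        using \<open>sin l \<noteq> 0\<close> by (simp add: sin_diff field_simps)
      then show ?thesis using \<open>sin l \<noteq> 0\<close> by (simp add: \<theta>(3) p q scaleR_add_right flip: scaleR_add_left add.assoc)
    qed
    moreover have "norm x = 1" by (simp add: \<theta>(3) norm1)
    moreover have "if l > pi then sin (l - \<theta>) / sin l \<le> 0 \<or> sin \<theta> / sin l \<le> 0
      else 0 \<le> sin (l - \<theta>) / sin l \<and> 0 \<le> sin \<theta> / sin l"
    proof (cases "l > pi")
      case True
      then have "sin l < 0" using l by (simp add: sin_lt_zero)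
      moreover have "0 \<le> sin (l - \<theta>) \<or> 0 \<le> sin \<theta>"
        using sin_ge_zero[of \<theta>] sin_ge_zero[of "l - \<theta>"] \<theta> l by linarith
      ultimately show ?thesis using True by (auto simp: divide_le_0_iff)
    next
      case False
      then have "0 < sin l" using l \<open>l \<noteq> pi\<close> by (simp add: sin_gt_zero)
      then show ?thesis using False sin_ge_zero[of \<theta>] sin_ge_zero[of "l - \<theta>"] \<theta> by simp
    qed
    ultimately show "x \<in> circular_arc (l > pi) p q" unfolding circular_arc_def by blast
  next
    fix x assume "x \<in> circular_arc (l > pi) p q"
    then obtain s t where x: "x = s *\<^sub>R p + t *\<^sub>R q" "norm x = 1"
      and st: "if l > pi then s \<le> 0 \<or> t \<le> 0 else 0 \<le> s \<and> 0 \<le> t"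
      unfolding circular_arc_def by blast
    have x': "x = (s + t * cos l) *\<^sub>R a + (t * sin l) *\<^sub>R b"
      by (simp add: x p q algebra_simps)
    then have "(s + t * cos l)\<^sup>2 + (t * sin l)\<^sup>2 = 1" using x(2) norm1 by simp
    then obtain \<theta> where \<theta>: "0 \<le> \<theta>" "\<theta> < 2 * pi" "s + t * cos l = cos \<theta>" "t * sin l = sin \<theta>"
      using sincos_total_2pi by metis
    have s: "s * sin l = sin (l - \<theta>)"
      by (simp add: sin_diff flip: \<theta>(3,4)) (simp add: algebra_simps)
    have sin_swap: "sin (l - \<theta>) = - sin (\<theta> - l)" by (metis minus_diff_eq sin_minus)
    \<comment> \<open>Beyond \<open>l\<close> both coefficients are positive if
      \<open>l > pi\<close>, and one of them is negative if \<open>l < pi\<close>.\<close>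
    have "\<theta> \<le> l"
    proof (rule ccontr)
      assume "\<not> \<theta> \<le> l"
      show False
      proof (cases "l > pi")
        case True
        then have "sin l < 0" "sin \<theta> < 0" using l \<theta> \<open>\<not> \<theta> \<le> l\<close> by (simp_all add: sin_lt_zero)
        moreover have "sin (l - \<theta>) < 0"
          using sin_gt_zero[of "\<theta> - l"] \<open>\<not> \<theta> \<le> l\<close> True \<theta>(2) by (simp add: sin_swap)
        ultimately have "0 < s" "0 < t" using s \<theta>(4)
          by (metis mult_less_0_iff not_less_iff_gr_or_eq)+
        then show False using st True by auto
      next
        case False
        then have "0 < sin l" using l \<open>l \<noteq> pi\<close> by (simp add: sin_gt_zero)
        then have "0 \<le> sin \<theta>" "0 \<le> sin (l - \<theta>)" using st False s \<theta>(4)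
          by (metis mult_nonneg_nonneg less_imp_le)+
        then have "\<theta> \<le> pi" using sin_lt_zero[of \<theta>] \<theta> by linarith
        then have "sin (l - \<theta>) < 0"
          using sin_gt_zero[of "\<theta> - l"] \<open>\<not> \<theta> \<le> l\<close> l by (simp add: sin_swap)
        with \<open>0 \<le> sin (l - \<theta>)\<close> show False by simp
      qed
    qed
    then show "x \<in> path_image g" unfolding img x' \<theta>(3,4) using \<theta>(1) by auto
  qed
  then show ?thesis ..
qed

text \<open>As \<open>p\<close> and \<open>q\<close> are neither equal nor antipodal,
  \<open>cross3 p q\<close> is the normal of a great circle through both. A vanishing determinant
  would put \<open>r\<close> on it.\<close>

lemma triple_nonzero:
  assumes "norm p = 1" "norm q = 1" "p \<noteq> q" "p \<noteq> - q" "norm r = 1"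
    and "\<not> (\<exists>C. great_circle C \<and> {p, q, r} \<subseteq> C)"
  shows "triple p q r \<noteq> 0"
proof
  assume "triple p q r = 0"
  have "cross3 p q \<noteq> 0"
  proof
    assume "cross3 p q = 0"
    then have "(p \<bullet> q)\<^sup>2 = 1" using norm_cross_dot[of p q] assms by simp
    then have "p \<bullet> q = 1 \<or> p \<bullet> q = -1" by (simp add: power2_eq_1_iff)
    moreover have "(p - q) \<bullet> (p - q) = 2 - 2 * (p \<bullet> q)" "(p + q) \<bullet> (p + q) = 2 + 2 * (p \<bullet> q)"
      using assms(1,2) by (simp_all add: inner_diff_left inner_diff_right inner_add_left inner_add_right
        inner_commute norm_eq_1)
    ultimately have "p - q = 0 \<or> p + q = 0" by auto
    then show False using assms(3,4) by (auto simp: eq_neg_iff_add_eq_0)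
  qed
  moreover have "{p, q, r} \<subseteq> {x \<in> sphere 0 1. cross3 p q \<bullet> x = 0}"
    using assms \<open>triple p q r = 0\<close> by (simp add: dot_cross_self triple_def)
  ultimately show False using assms(6) unfolding great_circle_def by blast
qed

section \<open>From great-circle drawings to orientations\<close>

lemma uedges_pair: "{u, v} \<in> uedges G \<longleftrightarrow> u \<rightarrow>\<^bsub>G\<^esub> v \<or> v \<rightarrow>\<^bsub>G\<^esub> u"
  by (auto simp: uedges_def doubleton_eq_iff image_iff)

lemma great_circle_thrackle_sign_thrackle:
  assumes G: "loopfree_digraph G" and th: "great_circle_thrackle G pos c" and gp: "general_position G pos"
  shows "\<exists>long. sign_thrackle (verts G) (uedges G) (\<lambda>x y z. 0 < triple (pos x) (pos y) (pos z)) long"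
proof -
  interpret loopfree_digraph G by (rule G)
  have norm: "norm (pos v) = 1" if "v \<in> verts G" for v
    using th that by (auto simp: great_circle_thrackle_def)
  have thrackle: "thrackle G pos c" and gca: "\<And>e. e \<in> uedges G \<Longrightarrow> great_circle_arc (c e)"
    using th unfolding great_circle_thrackle_def by blast+
  have drawing: "drawing G pos c" using thrackle unfolding thrackle_def by (rule conjunct1)
  have inj: "inj_on pos (verts G)" using drawing unfolding drawing_def by (rule conjunct1)
  note arc_ends = drawing[unfolded drawing_def, THEN conjunct2, rule_format, THEN conjunct2]
  have once: "\<exists>!x. x \<in> path_image (c e) \<inter> path_image (c f)"
    if "e \<in> uedges G" "f \<in> uedges G" "e \<noteq> f" for e f
    using thrackle[unfolded thrackle_def, THEN conjunct2, THEN conjunct2, rule_format, OF that] .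
  have nz: "triple (pos u) (pos v) (pos w) \<noteq> 0" if "{u, v, w} \<subseteq> verts G" "distinct [u, v, w]" for u v w
  proof (rule triple_nonzero)
    have V: "u \<in> verts G" "v \<in> verts G" "w \<in> verts G" "u \<noteq> v" using that by auto
    then show "norm (pos u) = 1" "norm (pos v) = 1" "norm (pos w) = 1" by (simp_all add: norm)
    show "pos u \<noteq> pos v" using V inj by (meson inj_onD)
    show "pos u \<noteq> - pos v" "\<not> (\<exists>C. great_circle C \<and> {pos u, pos v, pos w} \<subseteq> C)"
      using gp V that(2) unfolding general_position_def by blast+
  qed
  have edge: "u \<in> verts G" "v \<in> verts G" "u \<noteq> v" if "{u, v} \<in> uedges G" for u v
    using that adj_in_verts adj_not_same unfolding uedges_pair by blast+
  have image: "\<exists>l. path_image (c {u, v}) = circular_arc l (pos u) (pos v)" if E: "{u, v} \<in> uedges G" for u v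
  proof -
    note uv = edge[OF E]
    have anti: "pos u \<noteq> - pos v" "pos v \<noteq> - pos u"
      using gp uv uv(3)[symmetric] unfolding general_position_def by blast+
    consider "pathstart (c {u, v}) = pos u" "pathfinish (c {u, v}) = pos v"
      | "pathstart (c {u, v}) = pos v" "pathfinish (c {u, v}) = pos u"
      using arc_ends[OF E] by (auto simp: doubleton_eq_iff)
    then show ?thesis
    proof cases
      case 1
      then show ?thesis using great_circle_arc_path_image[OF gca[OF E] _ _ anti(1)] by blast
    next
      case 2
      then show ?thesis unfolding circular_arc_commute[of _ "pos u"]
        using great_circle_arc_path_image[OF gca[OF E] _ _ anti(2)] by blast
    qed
  qed
  \<comment> \<open>\<open>long\<close> must be a function of the unordered edge; the symmetry of
    \<open>circular_arc\<close> makes one value of \<open>l\<close> serve both orders of the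
    ends.\<close>
  have "\<exists>l. \<forall>u v. e = {u, v} \<longrightarrow> path_image (c e) = circular_arc l (pos u) (pos v)"
    if e: "e \<in> uedges G" for e
  proof -
    obtain u v where uv: "e = {u, v}" using e unfolding uedges_def by blast
    then obtain l where "path_image (c e) = circular_arc l (pos u) (pos v)" using image e by blast
    then show ?thesis unfolding uv doubleton_eq_iff using circular_arc_commute by blast
  qed
  then have "\<exists>long. \<forall>e\<in>uedges G. \<forall>u v. e = {u, v} \<longrightarrow> path_image (c e) = circular_arc (long e) (pos u) (pos v)"
    by (intro bchoice ballI)
  then obtain long where
    "\<forall>e\<in>uedges G. \<forall>u v. e = {u, v} \<longrightarrow> path_image (c e) = circular_arc (long e) (pos u) (pos v)"
    by (rule exE)
  note long = this[rule_format, OF _ refl]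
  have "sign_thrackle (verts G) (uedges G) (\<lambda>x y z. 0 < triple (pos x) (pos y) (pos z)) long"
  proof
    fix x y z assume "{x, y, z} \<subseteq> verts G" "distinct [x, y, z]"
    then show "0 < triple (pos y) (pos x) (pos z) \<longleftrightarrow> \<not> 0 < triple (pos x) (pos y) (pos z)"
      using nz[of x y z] triple_swap[of "pos y" "pos x" "pos z"] by auto
  next
    fix x y z
    show "0 < triple (pos y) (pos z) (pos x) \<longleftrightarrow> 0 < triple (pos x) (pos y) (pos z)"
      by (simp add: triple_rotate[of "pos y"])
  next
    fix x a b c d assume V: "{x, a, b, c, d} \<subseteq> verts G" "distinct [x, a, b, c, d]"
    let ?t = "\<lambda>a b. triple (pos x) (pos a) (pos b)"
    have nz': "?t a b \<noteq> 0" "?t c d \<noteq> 0" "?t a d \<noteq> 0" "?t b c \<noteq> 0" "?t a c \<noteq> 0" "?t b d \<noteq> 0"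
      by (rule nz; use V in auto)+
    then have sgn: "0 < ?t a b * ?t c d \<longleftrightarrow> (0 < ?t a b) = (0 < ?t c d)"
      "0 < ?t a d * ?t b c \<longleftrightarrow> (0 < ?t a d) = (0 < ?t b c)"
      "0 < - (?t a c * ?t b d) \<longleftrightarrow> (0 < ?t a c) \<noteq> (0 < ?t b d)"
      unfolding neg_0_less_iff_less zero_less_mult_iff mult_less_0_iff by linarith+
    have "?t a b * ?t c d \<noteq> 0" "?t a d * ?t b c \<noteq> 0" "?t a c * ?t b d \<noteq> 0"
      using nz' by simp_all
    then have "\<not> ((0 < ?t a b * ?t c d) = (0 < ?t a d * ?t b c) \<and>
        (0 < ?t a b * ?t c d) = (0 < - (?t a c * ?t b d)))"
      using triple_grassmann_pluecker[of "pos x" "pos a" "pos b" "pos c" "pos d"] by linarith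
    then show "\<not> (((0 < ?t a b) = (0 < ?t c d)) = ((0 < ?t a d) = (0 < ?t b c)) \<and>
      ((0 < ?t a b) = (0 < ?t c d)) = ((0 < ?t a c) \<noteq> (0 < ?t b d)))"
      unfolding sgn .
  next
    show "\<Union>(uedges G) \<subseteq> verts G" using adj_in_verts by (auto simp: uedges_def)
  next
    fix v a b assume E: "{v, a} \<in> uedges G" "{v, b} \<in> uedges G" "a \<noteq> b"
    show "\<not> (long {v, a} \<and> long {v, b})"
    proof
      assume "long {v, a} \<and> long {v, b}"
      \<comment> \<open>With coefficient 0 on \<open>q\<close> the condition for a long arc holds
        whatever the coefficient of \<open>pos v\<close>.\<close>
      moreover have "pos v \<in> circular_arc True (pos v) q" "- pos v \<in> circular_arc True (pos v) q" for q
      proof -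
        have "pos v = 1 *\<^sub>R pos v + 0 *\<^sub>R q" "- pos v = (- 1) *\<^sub>R pos v + 0 *\<^sub>R q" by simp_all
        moreover have "norm (pos v) = 1" "norm (- pos v) = 1" using norm[OF edge(1)[OF E(1)]] by simp_all
        moreover have "(0::real) \<le> 0" by simp
        ultimately show "pos v \<in> circular_arc True (pos v) q" "- pos v \<in> circular_arc True (pos v) q"
          unfolding circular_arc_def mem_Collect_eq if_True by blast+
      qed
      ultimately have "{pos v, - pos v} \<subseteq> path_image (c {v, a}) \<inter> path_image (c {v, b})"
        unfolding long[OF E(1)] long[OF E(2)] by simp
      moreover have "pos v \<noteq> - pos v" using norm[OF edge(1)[OF E(1)]]
        by (metis norm_zero one_neq_zero eq_neg_iff_add_eq_0 scaleR_2 scaleR_eq_0_iff zero_neq_numeral)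
      ultimately show False using once[OF E(1,2)] E(3) unfolding doubleton_eq_iff by blast
    qed
  next
    fix a b c' d assume E: "{a, b} \<in> uedges G" "{c', d} \<in> uedges G" "distinct [a, b, c', d]"
    then have "{a, b} \<noteq> {c', d}" by (auto simp: doubleton_eq_iff)
    have V: "{a, b, c', d} \<subseteq> verts G" using edge E by auto
    have "\<exists>!x. x \<in> circular_arc (long {a, b}) (pos a) (pos b) \<inter> circular_arc (long {c', d}) (pos c') (pos d)"
      using once[OF E(1,2) \<open>{a, b} \<noteq> {c', d}\<close>] unfolding long[OF E(1)] long[OF E(2)] .
    then show "crosses_once (\<lambda>x y z. 0 < triple (pos x) (pos y) (pos z)) long a b c' d"
      unfolding crosses_once_def using V E(3) by (intro circular_arcs_crossing nz) auto
  qed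
  then show ?thesis by (rule exI[of _ long])
qed

section \<open>Longest paths in trees\<close>

lemma vwalk_iff_successively:
  "vwalk p G \<longleftrightarrow> p \<noteq> [] \<and> set p \<subseteq> verts G \<and> successively (dominates G) p"
proof -
  have "set (vwalk_arcs p) \<subseteq> arcs_ends G \<longleftrightarrow> successively (dominates G) p"
    by (induction p rule: vwalk_arcs.induct) auto
  then show ?thesis by (auto simp: vwalk_def)
qed

lemma vwalk_uedges_append:
  "p \<noteq> [] \<Longrightarrow> q \<noteq> [] \<Longrightarrow>
    vwalk_uedges (p @ q) = vwalk_uedges p \<union> vwalk_uedges q \<union> {{last p, hd q}}"
  by (induction p rule: vwalk_arcs.induct) (auto simp: vwalk_uedges_def)

lemma vwalk_uedges_subset_set: "e \<in> vwalk_uedges p \<Longrightarrow> e \<subseteq> set p"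
  by (auto simp: vwalk_uedges_def elim: in_set_vwalk_arcsE)

text \<open>The tail of an arc of a walk sits before the last position. Hence, if only the last
  vertex of a path is on the spine, no edge of the path is a spine edge.\<close>

lemma vwalk_uedges_meets_butlast:
  assumes "e \<in> vwalk_uedges p"
  shows "e \<inter> set (butlast p) \<noteq> {}"
proof -
  obtain u v where "(u, v) \<in> set (vwalk_arcs p)" "e = {u, v}"
    using assms by (auto simp: vwalk_uedges_def)
  moreover have "u \<in> set (butlast p)" if "(u, v) \<in> set (vwalk_arcs p)" for u v
    using that by (induction p rule: vwalk_arcs.induct) auto
  ultimately show ?thesis by blast
qed

lemma vwalk_uedges_subset:
  "vwalk p G \<Longrightarrow> vwalk_uedges p \<subseteq> uedges G"
  by (auto simp: vwalk_uedges_def uedges_def)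

lemma set_eq_ends_internal:
  "set s \<subseteq> {hd s, last s} \<union> internal_verts s"
  unfolding internal_verts_def
  by (cases s; cases "tl s" rule: rev_cases) auto

text \<open>Bridge to walks given by lists of arcs, in terms of which \<open>cycle\<close> and
  \<open>\<mu>\<close> are defined.\<close>

lemma (in wf_digraph) vwalk_imp_awalk:
  "vwalk p G \<Longrightarrow> \<exists>es. awalk (hd p) es (last p) \<and> awalk_verts (hd p) es = p"
proof (induction p rule: vwalk_induct)
  case (Base u)
  then show ?case by (intro exI[of _ "[]"]) (simp add: awalk_Nil_iff)
next
  case (Cons u v p)
  then obtain es e where "awalk v es (last (v # p))" "awalk_verts v es = v # p"
    "e \<in> arcs G" "tail G e = u" "head G e = v" by auto
  then show ?case by (intro exI[of _ "e # es"]) (auto simp: awalk_Cons_iff)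
qed

lemma (in wf_digraph) mu_le_vwalk_length:
  assumes "vwalk p G"
  shows "\<mu> (\<lambda>_. 1) (hd p) (last p) \<le> ereal (length p - 1)"
proof -
  obtain es where es: "awalk (hd p) es (last p)" "awalk_verts (hd p) es = p"
    using vwalk_imp_awalk[OF assms] by blast
  have "awalk_cost (\<lambda>_. 1) es = length p - 1"
    using es(2) length_awalk_verts[of "hd p" es] by (simp add: awalk_cost_def sum_list_triv)
  then show ?thesis using min_cost_le_walk_cost[OF es(1), of "\<lambda>_. 1"] by simp
qed

section \<open>Paths attached to a longest path\<close>

context graph
begin

lemma dominates_sym: "u \<rightarrow> v \<Longrightarrow> v \<rightarrow> u"
  by (rule arcs_ends_symmetric[OF sym_arcs])

lemma vwalk_rev: "vwalk (rev p) G \<longleftrightarrow> vwalk p G"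
proof -
  have "successively (dominates G) (rev q)" if "successively (dominates G) q" for q
    unfolding successively_rev using that by (rule successively_mono) (rule dominates_sym)
  from this[of p] this[of "rev p"] show ?thesis by (auto simp: vwalk_iff_successively)
qed

lemma longest_path_exists:
  assumes "verts G \<noteq> {}"
  shows "\<exists>s. longest_path G s"
proof -
  obtain v where "v \<in> verts G" using assms by blast
  then have "vpath [v] G" by (simp add: vpath_def)
  moreover have "length p \<le> card (verts G)" if "vpath p G" for p
    using that card_mono[OF finite_verts, of "set p"] distinct_card[of p] by (auto simp: vpath_def vwalk_def)
  ultimately show ?thesis
    unfolding longest_path_def using ex_has_greatest_nat[of "\<lambda>p. vpath p G" "[v]" length "Suc (card (verts G))"]
    by (meson le_imp_less_Suc)
qed

text \<open>Replacing either side of the spine at \<open>w\<close> by the attached path gives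
  another path, which cannot be longer than the spine.\<close>

lemma attached_path_length:
  assumes s: "longest_path G (s1 @ w # s2)"
    and p: "vpath (p @ [w]) G" "set p \<inter> set (s1 @ w # s2) = {}"
  shows "length p \<le> length s1" "length p \<le> length s2"
proof -
  have vp: "vpath (s1 @ w # s2) G" and max: "\<And>q. vpath q G \<Longrightarrow> length q \<le> length (s1 @ w # s2)"
    using s by (simp_all add: longest_path_def)
  have "vwalk (w # rev p) G" using p(1) vwalk_rev[of "p @ [w]"] by (simp add: vpath_def)
  then have "vpath (p @ w # s2) G" "vpath (s1 @ w # rev p) G"
    using vp p by (auto simp: vpath_def vwalk_iff_successively successively_append_iff)
  from this[THEN max] show "length p \<le> length s1" "length p \<le> length s2" by simp_all
qed

lemma attached_path_last_internal:
  assumes s: "longest_path G s" and p: "vpath (p @ [w]) G" "p \<noteq> []" "set p \<inter> set s = {}" "w \<in> set s"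
  shows "w \<in> internal_verts s"
proof -
  obtain s1 s2 where s12: "s = s1 @ w # s2" using p(4) by (meson split_list)
  then have "s1 \<noteq> []" "s2 \<noteq> []" using attached_path_length[OF s[unfolded s12] p(1) p(3)[unfolded s12]] p(2) by auto
  then show ?thesis by (cases s1) (auto simp: s12 internal_verts_def butlast_append)
qed

lemma attached_path_leg:
  assumes "longest_path G s" "vpath (p @ [w]) G" "p \<noteq> []" "set p \<inter> set s = {}" "w \<in> set s"
  shows "leg G s (p @ [w])"
proof -
  have "vwalk_uedges (p @ [w]) \<inter> vwalk_uedges s = {}"
    using vwalk_uedges_meets_butlast[of _ "p @ [w]"] vwalk_uedges_subset_set[of _ s] assms(4)
    by (simp add: butlast_append) blast
  then show ?thesis using attached_path_last_internal[OF assms] assms(2) by (simp add: leg_def)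
qed

text \<open>Cut a path from \<open>v\<close> to \<open>hd s\<close> at its first vertex in
  \<open>s\<close>; \<open>p\<close> is empty if \<open>v\<close> is itself in
  \<open>s\<close>.\<close>

lemma ex_attached_path:
  assumes "Digraph_Component.connected G" "s \<noteq> []" "set s \<subseteq> verts G" "v \<in> verts G"
  shows "\<exists>p w. vpath (p @ [w]) G \<and> hd (p @ [w]) = v \<and> set p \<inter> set s = {} \<and> w \<in> set s"
proof -
  have "hd s \<in> verts G" using assms(2,3) hd_in_set by blast
  then have "v \<rightarrow>\<^sup>* hd s"
    using symmetric_connected_imp_strongly_connected[OF sym_arcs assms(1)] assms(4)
    unfolding strongly_connected_def by blast
  then obtain q where q: "vpath q G" "hd q = v" "last q = hd s" by (auto simp: reachable_vpath_conv)
  then have "\<exists>x \<in> set q. x \<in> set s" using \<open>s \<noteq> []\<close> by (metis hd_in_set last_in_set vpath_def vwalk_def)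
  then obtain p w r where pw: "q = p @ w # r" "w \<in> set s" "\<forall>x\<in>set p. x \<notin> set s"
    using split_list_first_propE[of q "\<lambda>x. x \<in> set s"] by blast
  have "vpath (p @ [w]) G" using q(1) unfolding pw vpath_def
    by (auto simp: vwalk_iff_successively successively_append_iff)
  moreover have "hd (p @ [w]) = v" using q(2) pw by (cases p) auto
  ultimately show ?thesis using pw by blast
qed

text \<open>The chord closes the segment from \<open>u\<close> to \<open>v\<close>; a nonempty
  \<open>s2\<close> makes the cycle have at least three arcs.\<close>

lemma chord_of_path_cycle:
  assumes "vpath (s1 @ u # s2 @ v # s3) G" "s2 \<noteq> []" "v \<rightarrow> u"
  shows "\<exists>c. cycle c \<and> 3 \<le> length c"
proof -
  have "successively (dominates G) (s1 @ (u # s2) @ v # s3)"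
    using assms(1) by (simp add: vpath_def vwalk_iff_successively)
  then have "successively (dominates G) ((u # s2) @ [v])"
    unfolding successively_append_iff by simp
  then have "vwalk (v # u # s2 @ [v]) G"
    using assms by (auto simp: vpath_def vwalk_iff_successively)
  then obtain es where es: "awalk v es v" "awalk_verts v es = v # u # s2 @ [v]"
    using vwalk_imp_awalk[of "v # u # s2 @ [v]"] by auto
  have "cycle es" unfolding cycle_def
    using es assms by (intro exI[of _ v]) (auto simp: vpath_def)
  moreover have "3 \<le> length es" using es(2) length_awalk_verts[of v es] assms(2)
    by (cases s2) simp_all
  ultimately show ?thesis by blast
qed

text \<open>An edge with an end off the spine is the first edge of an attached path, which is a leg.
  An edge with both ends on the spine joins consecutive vertices, as it would otherwise be a chord
  closing a cycle.\<close>

lemma uedge_in_spine_or_leg: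
  assumes G: "undirected_tree G" and s: "longest_path G s" and uv: "u \<rightarrow> v"
  shows "{u, v} \<in> vwalk_uedges s \<union> (\<Union>l\<in>{l. leg G s l}. vwalk_uedges l)"
proof -
  have conn: "Digraph_Component.connected G" and acyc: "\<not> (\<exists>c. cycle c \<and> 3 \<le> length c)"
    using G by (auto simp: undirected_tree_def)
  have vs: "vpath s G" using s by (simp add: longest_path_def)
  have off: "\<exists>l. leg G s l \<and> {u, v} \<in> vwalk_uedges l" if "u \<rightarrow> v" "u \<notin> set s" for u v
  proof -
    have "u \<noteq> v" using \<open>u \<rightarrow> v\<close> adj_not_same by blast
    have "v \<rightarrow> u" using \<open>u \<rightarrow> v\<close> dominates_sym by blast
    have verts: "u \<in> verts G" "v \<in> verts G" using \<open>u \<rightarrow> v\<close> adj_in_verts by auto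
    obtain p w where p: "vpath (p @ [w]) G" "hd (p @ [w]) = v" "set p \<inter> set s = {}" "w \<in> set s"
      using ex_attached_path[OF conn _ _ verts(2), of s] vs by (auto simp: vpath_def vwalk_def)
    have "\<exists>q. vpath (q @ [w]) G \<and> set q \<inter> set s = {} \<and> q \<noteq> [] \<and> {u, v} \<in> vwalk_uedges (q @ [w])"
    proof (cases "u \<in> set (p @ [w])")
      case False
      have "vpath ((u # p) @ [w]) G" using p verts \<open>u \<rightarrow> v\<close> False
        by (auto simp: vpath_def vwalk_iff_successively successively_Cons)
      moreover have "{u, v} \<in> vwalk_uedges ((u # p) @ [w])" using p(2) by (auto simp: vwalk_uedges_def)
      ultimately show ?thesis using p \<open>u \<notin> set s\<close> by (intro exI[of _ "u # p"]) auto
    next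
      case True
      then have "u \<in> set p" using p(4) that(2) by auto
      then obtain p1 p2 where p12: "p = p1 @ u # p2" by (meson split_list)
      then have "p1 \<noteq> []" "hd p1 = v" using p(2) \<open>u \<noteq> v\<close> by (cases p1; auto)+
      then have "v \<in> set p1" by auto
      \<comment> \<open>The path from \<open>v\<close> runs through \<open>u\<close>; the edge
        itself replaces the section between them, so that the new path starts with this
        edge.\<close>
      have "vpath ((v # u # p2) @ [w]) G" using p verts \<open>v \<rightarrow> u\<close> \<open>v \<in> set p1\<close>
        by (auto simp: vpath_def vwalk_iff_successively successively_Cons successively_append_iff p12)
      moreover have "{u, v} \<in> vwalk_uedges ((v # u # p2) @ [w])" by (auto simp: vwalk_uedges_def)
      ultimately show ?thesis using p \<open>v \<in> set p1\<close> by (intro exI[of _ "v # u # p2"]) (auto simp: p12)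
    qed
    then show ?thesis using attached_path_leg[OF s] p(4) by blast
  qed
  have on: "{u, v} \<in> vwalk_uedges s" if "u \<rightarrow> v" "s = s1 @ u # s2 @ v # s3" for u v s1 s2 s3
  proof -
    have "s2 = []" using chord_of_path_cycle acyc vs that dominates_sym by metis
    then have "s = s1 @ u # v # s3" using that(2) by simp
    moreover have "{u, v} \<in> vwalk_uedges (u # v # s3)" by (simp add: vwalk_uedges_def)
    ultimately show ?thesis using vwalk_uedges_append[of s1 "u # v # s3"] by (cases "s1 = []") auto
  qed
  show ?thesis
  proof (cases "u \<in> set s \<and> v \<in> set s")
    case True
    have "u \<noteq> v" using uv adj_not_same by blast
    obtain s1 s2 where s12: "s = s1 @ u # s2" using True by (meson split_list)
    then consider "v \<in> set s1" | "v \<in> set s2" using True \<open>u \<noteq> v\<close> by auto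
    then have "{u, v} \<in> vwalk_uedges s"
    proof cases
      case 1
      then obtain t1 t2 where "s1 = t1 @ v # t2" by (meson split_list)
      then show ?thesis using on[OF dominates_sym[OF uv], of t1 t2 s2] s12 by (simp add: insert_commute)
    next
      case 2
      then obtain t1 t2 where "s2 = t1 @ v # t2" by (meson split_list)
      then show ?thesis using on[OF uv, of s1 t1 t2] s12 by simp
    qed
    then show ?thesis ..
  next
    case False
    then obtain l where "leg G s l" "{u, v} \<in> vwalk_uedges l"
      using off[OF uv] off[OF dominates_sym[OF uv]] by (metis insert_commute)
    then show ?thesis by blast
  qed
qed

text \<open>By \<open>attached_path_length\<close> the spine has at least three vertices on either
  side of \<open>w\<close>, enough for two further legs of length three.\<close>

lemma spider_if_long_attached_path:
  assumes s: "longest_path G s"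
    and p: "vpath (p @ [w]) G" "set p \<inter> set s = {}" "w \<in> set s" "3 \<le> length p"
  shows "\<exists>a1 a2 a3 b1 b2 b3 c1 c2 c3. a3 \<rightarrow> a2 \<and> a2 \<rightarrow> a1 \<and> a1 \<rightarrow> w \<and>
    b3 \<rightarrow> b2 \<and> b2 \<rightarrow> b1 \<and> b1 \<rightarrow> w \<and> c3 \<rightarrow> c2 \<and> c2 \<rightarrow> c1 \<and> c1 \<rightarrow> w \<and>
    distinct [w, a1, a2, a3, b1, b2, b3, c1, c2, c3]"
proof -
  have last3: "\<exists>ys z3 z2 z1. xs = ys @ [z3, z2, z1]" if "3 \<le> length xs" for xs :: "'a list"
  proof -
    have "length (drop (length xs - 3) xs) = 3" using that by simp
    then show ?thesis
      by (metis (no_types, lifting) append_take_drop_id length_0_conv length_Suc_conv numeral_3_eq_3)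
  qed
  obtain s1 s2 where s12: "s = s1 @ w # s2" using p(3) by (meson split_list)
  \<comment> \<open>\<open>s2\<close> is reversed so that all three lists are read towards
    \<open>w\<close>.\<close>
  then have l: "3 \<le> length s1" "3 \<le> length (rev s2)" using attached_path_length[OF s[unfolded s12] p(1) p(2)[unfolded s12]] p(4) by simp_all
  obtain as a1 a2 a3 bs b1 b2 b3 cs c1 c2 c3 where
    abc: "p = as @ [a3, a2, a1]" "s1 = bs @ [b3, b2, b1]" "rev s2 = cs @ [c3, c2, c1]"
    using last3[OF p(4)] last3[OF l(1)] last3[OF l(2)] by blast
  then have s2: "s2 = c1 # c2 # c3 # rev cs" by (simp add: rev_swap)
  have "successively (dominates G) [a3, a2, a1, w]" "successively (dominates G) [b3, b2, b1, w]"
    "successively (dominates G) [w, c1, c2, c3]" "distinct (s1 @ w # s2)" "distinct p"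
    using s p(1) by (auto simp: s12 s2 abc longest_path_def vpath_def vwalk_iff_successively successively_append_iff)
  then have "a3 \<rightarrow> a2 \<and> a2 \<rightarrow> a1 \<and> a1 \<rightarrow> w \<and> b3 \<rightarrow> b2 \<and> b2 \<rightarrow> b1 \<and> b1 \<rightarrow> w \<and> c3 \<rightarrow> c2 \<and> c2 \<rightarrow> c1 \<and> c1 \<rightarrow> w \<and>
    distinct [w, a1, a2, a3, b1, b2, b3, c1, c2, c3]"
    using p(2) dominates_sym[of w c1] dominates_sym[of c1 c2] dominates_sym[of c2 c3]
    by (auto simp: s12 s2 abc)
  then show ?thesis by blast
qed


text \<open>The spine is any longest path, with all of its legs. Internal vertices of the spine have
  distance 0, its ends at most 1; a vertex off the spine has distance at most 2, since an attached
  path with three edges would produce a spider.\<close>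

theorem augmented_caterpillar_if_no_spider:
  assumes tree: "undirected_tree G"
    and no_spider: "\<And>u a1 a2 a3 b1 b2 b3 c1 c2 c3. \<lbrakk>a3 \<rightarrow> a2; a2 \<rightarrow> a1; a1 \<rightarrow> u; b3 \<rightarrow> b2; b2 \<rightarrow> b1; b1 \<rightarrow> u;
      c3 \<rightarrow> c2; c2 \<rightarrow> c1; c1 \<rightarrow> u; distinct [u, a1, a2, a3, b1, b2, b3, c1, c2, c3]\<rbrakk> \<Longrightarrow> False"
  shows "augmented_caterpillar G"
proof (cases "card (verts G) \<le> 2")
  case True
  then show ?thesis using tree by (simp add: augmented_caterpillar_def)
next
  case False
  then have "verts G \<noteq> {}" by auto
  then obtain s where s: "longest_path G s" using longest_path_exists by blast
  then have vs: "s \<noteq> []" "set s \<subseteq> verts G" "distinct s" "vwalk s G"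
    by (auto simp: longest_path_def vpath_def vwalk_def)
  have conn: "Digraph_Component.connected G" using tree by (simp add: undirected_tree_def)
  have attached: "\<exists>p w. vpath (p @ [w]) G \<and> hd (p @ [w]) = v \<and> set p \<inter> set s = {} \<and> w \<in> set s \<and> p \<noteq> []"
    if "v \<in> verts G" "v \<notin> set s" for v
    using ex_attached_path[OF conn vs(1,2) that(1)] that(2)
    by (metis append_Nil list.sel(1))
  \<comment> \<open>A shorter spine would miss a vertex, and a path attached from there would force
    spine vertices on both sides of its end.\<close>
  have len: "3 \<le> length s"
  proof (rule ccontr)
    assume "\<not> 3 \<le> length s"
    then have "card (set s) < card (verts G)" using False distinct_card[OF vs(3)] by simp
    then obtain v where "v \<in> verts G" "v \<notin> set s" using card_mono[of "set s" "verts G"] by fastforce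
    then obtain p w where p: "vpath (p @ [w]) G" "set p \<inter> set s = {}" "w \<in> set s" "p \<noteq> []"
      using attached by blast
    obtain s1 s2 where s12: "s = s1 @ w # s2" using p(3) by (meson split_list)
    have "s1 \<noteq> []" "s2 \<noteq> []"
      using attached_path_length[OF s[unfolded s12] p(1) p(2)[unfolded s12]] p(4) by auto
    then show False using \<open>\<not> 3 \<le> length s\<close> s12 by (cases s1; cases s2) simp_all
  qed
  define L where "L = {l. leg G s l}"
  have "verts G = set s \<union> (\<Union>l\<in>L. set l)"
  proof (intro equalityI subsetI)
    fix v assume "v \<in> verts G"
    show "v \<in> set s \<union> (\<Union>l\<in>L. set l)"
    proof (cases "v \<in> set s")
      case False
      then obtain p w where p: "vpath (p @ [w]) G" "hd (p @ [w]) = v" "set p \<inter> set s = {}" "w \<in> set s" "p \<noteq> []"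
        using attached \<open>v \<in> verts G\<close> by blast
      then have "p @ [w] \<in> L" using attached_path_leg[OF s] by (simp add: L_def)
      moreover have "v \<in> set (p @ [w])" using p(2) by (metis hd_in_set snoc_eq_iff_butlast)
      ultimately show ?thesis by blast
    qed simp
  next
    fix v assume "v \<in> set s \<union> (\<Union>l\<in>L. set l)"
    then show "v \<in> verts G" using vs(2) by (auto simp: L_def leg_def vpath_def vwalk_def)
  qed
  moreover have "uedges G = vwalk_uedges s \<union> (\<Union>l\<in>L. vwalk_uedges l)"
  proof
    show "uedges G \<subseteq> vwalk_uedges s \<union> (\<Union>l\<in>L. vwalk_uedges l)"
      using uedge_in_spine_or_leg[OF tree s] unfolding uedges_def L_def by auto
    show "vwalk_uedges s \<union> (\<Union>l\<in>L. vwalk_uedges l) \<subseteq> uedges G"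
      using vs(4) vwalk_uedges_subset by (fastforce simp: L_def leg_def vpath_def)
  qed
  moreover have "\<exists>w\<in>internal_verts s. \<mu> (\<lambda>_. 1) v w \<le> 2" if "v \<in> verts G" for v
  proof (cases "v \<in> set s")
    case True
    then consider "v \<in> internal_verts s" | "v = hd s" | "v = last s" using set_eq_ends_internal[of s] by blast
    then show ?thesis
    proof cases
      case 1
      have "\<mu> (\<lambda>_. 1) v v \<le> ereal (length [v] - 1)" using mu_le_vwalk_length[of "[v]"] that by simp
      also have "\<dots> \<le> 2" by simp
      finally show ?thesis using 1 by blast
    next
      case 2
      obtain a b y ys where "s = a # b # y # ys" using len by (auto simp: numeral_3_eq_3 Suc_le_length_iff)
      then obtain x r where s': "s = v # x # r" "r \<noteq> []" using 2 by simp
      then have "vwalk [v, x] G" using vs(4) by (auto simp: vwalk_iff_successively)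
      then have "\<mu> (\<lambda>_. 1) v x \<le> ereal (length [v, x] - 1)" using mu_le_vwalk_length[of "[v, x]"] by simp
      also have "\<dots> \<le> 2" by simp
      finally show ?thesis using s' by (auto simp: internal_verts_def)
    next
      case 3
      obtain a b y ys where "rev s = a # b # y # ys"
        using len length_rev[of s] by (metis Suc_le_length_iff numeral_3_eq_3)
      then have "s = rev (y # ys) @ [b, a]" by (simp add: rev_swap)
      then obtain x r where s': "s = r @ [x, v]" "r \<noteq> []" using 3
        by (metis last_appendR last_ConsL last_ConsR list.simps(3) rev_is_Nil_conv)
      then have "vwalk [v, x] G" using vs(2,4) dominates_sym
        by (simp add: vwalk_iff_successively successively_append_iff)
      then have "\<mu> (\<lambda>_. 1) v x \<le> ereal (length [v, x] - 1)" using mu_le_vwalk_length[of "[v, x]"] by simp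
      also have "\<dots> \<le> 2" by simp
      finally show ?thesis using s' by (auto simp: internal_verts_def butlast_append)
    qed
  next
    case False
    then obtain p w where p: "vpath (p @ [w]) G" "hd (p @ [w]) = v" "set p \<inter> set s = {}" "w \<in> set s" "p \<noteq> []"
      using attached \<open>v \<in> verts G\<close> by blast
    have "length p < 3"
    proof (rule ccontr)
      assume "\<not> length p < 3"
      then have "3 \<le> length p" by simp
      from spider_if_long_attached_path[OF s p(1,3,4) this] show False
        by (elim exE conjE) (rule no_spider)
    qed
    have "\<mu> (\<lambda>_. 1) v w \<le> ereal (length (p @ [w]) - 1)"
      using mu_le_vwalk_length[of "p @ [w]"] p(1,2) by (simp add: vpath_def)
    also have "\<dots> \<le> 2" using \<open>length p < 3\<close> by simp
    finally show ?thesis using attached_path_last_internal[OF s p(1,5,3,4)] by blast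
  qed
  ultimately show ?thesis
    using tree s unfolding augmented_caterpillar_def L_def
    by (intro conjI disjI2 exI[of _ s] exI[of _ "{l. leg G s l}"]) auto
qed

end

theorem theorem3p2:
  fixes G :: "('a,'b) pre_digraph"
  assumes "undirected_tree G"
    and "great_circle_thrackleable G"
  shows "augmented_caterpillar G"
proof -
  interpret graph G using assms(1) by (simp add: undirected_tree_def)
  obtain pos c where "great_circle_thrackle G pos c" "general_position G pos"
    using assms(2) unfolding great_circle_thrackleable_def by blast
  then obtain long where "sign_thrackle (verts G) (uedges G) (\<lambda>x y z. 0 < triple (pos x) (pos y) (pos z)) long"
    using great_circle_thrackle_sign_thrackle[OF loopfree_digraph_axioms] by blast
  then interpret sign_thrackle "verts G" "uedges G" "\<lambda>x y z. 0 < triple (pos x) (pos y) (pos z)" long .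
  show ?thesis
    \<comment> \<open>Each unordered edge required by \<open>no_spider\<close> is supplied by the
      arc in the direction in which it is written.\<close>
    by (rule augmented_caterpillar_if_no_spider[OF assms(1)])
      (rule no_spider; (unfold uedges_pair)?; (rule disjI1)?; assumption)
qed

end
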